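(* For $\vec{x}=(a,b,c,d,e,f,g)^T\in V$, $$S(a)\,A(b,1+b-e,1+b-f,1+b-g)\,K_{p_0}(\vec{x})-S(b)\,A(a,1+a-e,1+a-f,1+a-g)\,K_{p_1}(\vec{x})-S(b-a)\,A(a,b,c,d)\,L_3(\vec{x})=0.$$
   Context: $V=\{(a,b,c,d,e,f,g)^T\in\mathbb{C}^7: e+f+g-a-b-c-d=1\}$. ${}_4F_3\left[\begin{smallmatrix}a,b,c,d\\ e,f,g\end{smallmatrix};1\right]=\sum_{n\ge0}\frac{(a)_n(b)_n(c)_n(d)_n}{n!(e)_n(f)_n(g)_n}$, with $(a)_n$ the rising factorial. For $(a,b,c,d,e,f,g)^T\in V$, $$K(a;b,c,d;e,f,g)=\frac{{}_4F_3\left[\begin{smallmatrix}a,b,c,d\\ e,f,g\end{smallmatrix};1\right]}{\sin\pi a\,\Gamma(a)\Gamma(1+a-e)\Gamma(1+a-f)\Gamma(1+a-g)\Gamma(e)\Gamma(f)\Gamma(g)}+\frac{{}_4F_3\left[\begin{smallmatrix}a,1+a-e,1+a-f,1+a-g\\ 1+a-b,1+a-c,1+a-d\end{smallmatrix};1\right]}{\sin\pi a\,\Gamma(a)\Gamma(b)\Gamma(c)\Gamma(d)\Gamma(1+a-b)\Gamma(1+a-c)\Gamma(1+a-d)},$$ $$L(a,b,c,d;e;f,g)=\frac{{}_4F_3\left[\begin{smallmatrix}a,b,c,d\\ e,f,g\end{smallmatrix};1\right]}{\sin\pi e\,\Gamma(1+a-e)\Gamma(1+b-e)\Gamma(1+c-e)\Gamma(1+d-e)\Gamma(e)\Gamma(f)\Gamma(g)}-\frac{{}_4F_3\left[\begin{smallmatrix}1+a-e,1+b-e,1+c-e,1+d-e\\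 2-e,1+f-e,1+g-e\end{smallmatrix};1\right]}{\sin\pi e\,\Gamma(a)\Gamma(b)\Gamma(c)\Gamma(d)\Gamma(2-e)\Gamma(1+f-e)\Gamma(1+g-e)}.$$ Notation: $S(a_1,\dots,a_n)=\sin\pi a_1\cdots\sin\pi a_n$; $A(x,y,z,w)=\frac{1}{\Gamma(x)\Gamma(y)\Gamma(z)\Gamma(w)}$ (with $1/\Gamma=0$ at nonpositive integers). The relation is asserted for those $\vec{x}\in V$ at which the $K$ and $L$ functions occurring are defined (no lower parameter of an occurring series is a nonpositive integer, no sine in an occurring denominator vanishes). Here $K_{p_0}(\vec{x})=K(a;b,c,d;e,f,g)$, $K_{p_1}(\vec{x})=K(b;c,d,a;e,f,g)$, $L_3(\vec{x})=L(a,1+a-e,1+a-f,1+a-g;1+a-b;1+a-c,1+a-d)$. *)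

theory Defs
  imports "HOL-Analysis.Analysis"
begin

text \<open>
  Throughout, \<open>1/\<Gamma>\<close> is rendered by the entire function \<^const>\<open>rGamma\<close>, which vanishes at
  the nonpositive integers. Points of the complex 7-space are 7-tuples.
\<close>

type_synonym cvec7 =
  "complex \<times> complex \<times> complex \<times> complex \<times> complex \<times> complex \<times> complex"

definition Vset :: "cvec7 set" where
  "Vset = {(a, b, c, d, e, f, g). e + f + g - a - b - c - d = 1}"

text \<open>
  The real part of (sum of lower parameters) - (sum of upper parameters) is 1 for every series
  occurring in \<open>Kfun\<close> and \<open>Lfun\<close> at a point of \<open>Vset\<close>, so these series converge absolutely
  as soon as no lower parameter is a nonpositive integer.
\<close>

definition F43 ::
  "complex \<Rightarrow> complex \<Rightarrow> complex \<Rightarrow> complex \<Rightarrow> complex \<Rightarrow> complex \<Rightarrow> complex \<Rightarrow> complex" where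
  "F43 a b c d e f g =
     (\<Sum>n. (pochhammer a n * pochhammer b n * pochhammer c n * pochhammer d n) /
           (fact n * pochhammer e n * pochhammer f n * pochhammer g n))"

definition Sfun :: "complex list \<Rightarrow> complex" where
  "Sfun as = (\<Prod>a\<leftarrow>as. sin (of_real pi * a))"

definition Afun :: "complex \<Rightarrow> complex \<Rightarrow> complex \<Rightarrow> complex \<Rightarrow> complex" where
  "Afun x y z w = rGamma x * rGamma y * rGamma z * rGamma w"

definition Kfun ::
  "complex \<Rightarrow> complex \<Rightarrow> complex \<Rightarrow> complex \<Rightarrow> complex \<Rightarrow> complex \<Rightarrow> complex \<Rightarrow> complex" where
  "Kfun a b c d e f g =
     F43 a b c d e f g / sin (of_real pi * a)
       * rGamma a * rGamma (1 + a - e) * rGamma (1 + a - f) * rGamma (1 + a - g)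
       * rGamma e * rGamma f * rGamma g
   + F43 a (1 + a - e) (1 + a - f) (1 + a - g) (1 + a - b) (1 + a - c) (1 + a - d)
       / sin (of_real pi * a)
       * rGamma a * rGamma b * rGamma c * rGamma d
       * rGamma (1 + a - b) * rGamma (1 + a - c) * rGamma (1 + a - d)"

definition Lfun ::
  "complex \<Rightarrow> complex \<Rightarrow> complex \<Rightarrow> complex \<Rightarrow> complex \<Rightarrow> complex \<Rightarrow> complex \<Rightarrow> complex" where
  "Lfun a b c d e f g =
     F43 a b c d e f g / sin (of_real pi * e)
       * rGamma (1 + a - e) * rGamma (1 + b - e) * rGamma (1 + c - e) * rGamma (1 + d - e)
       * rGamma e * rGamma f * rGamma g
   - F43 (1 + a - e) (1 + b - e) (1 + c - e) (1 + d - e) (2 - e) (1 + f - e) (1 + g - e)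
       / sin (of_real pi * e)
       * rGamma a * rGamma b * rGamma c * rGamma d
       * rGamma (2 - e) * rGamma (1 + f - e) * rGamma (1 + g - e)"

text \<open>
  The arguments at which \<open>Kfun\<close> and \<open>Lfun\<close> are defined: the sine in the denominator does not
  vanish and no lower parameter of either series is a nonpositive integer.
\<close>

definition Kfun_defined ::
  "complex \<Rightarrow> complex \<Rightarrow> complex \<Rightarrow> complex \<Rightarrow> complex \<Rightarrow> complex \<Rightarrow> complex \<Rightarrow> bool" where
  "Kfun_defined a b c d e f g \<longleftrightarrow>
     sin (of_real pi * a) \<noteq> 0 \<and>
     e \<notin> \<int>\<^sub>\<le>\<^sub>0 \<and> f \<notin> \<int>\<^sub>\<le>\<^sub>0 \<and> g \<notin> \<int>\<^sub>\<le>\<^sub>0 \<and>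
     1 + a - b \<notin> \<int>\<^sub>\<le>\<^sub>0 \<and> 1 + a - c \<notin> \<int>\<^sub>\<le>\<^sub>0 \<and> 1 + a - d \<notin> \<int>\<^sub>\<le>\<^sub>0"

definition Lfun_defined ::
  "complex \<Rightarrow> complex \<Rightarrow> complex \<Rightarrow> complex \<Rightarrow> complex \<Rightarrow> complex \<Rightarrow> complex \<Rightarrow> bool" where
  "Lfun_defined a b c d e f g \<longleftrightarrow>
     sin (of_real pi * e) \<noteq> 0 \<and>
     e \<notin> \<int>\<^sub>\<le>\<^sub>0 \<and> f \<notin> \<int>\<^sub>\<le>\<^sub>0 \<and> g \<notin> \<int>\<^sub>\<le>\<^sub>0 \<and>
     2 - e \<notin> \<int>\<^sub>\<le>\<^sub>0 \<and> 1 + f - e \<notin> \<int>\<^sub>\<le>\<^sub>0 \<and> 1 + g - e \<notin> \<int>\<^sub>\<le>\<^sub>0"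

fun K_p0 :: "cvec7 \<Rightarrow> complex" where
  "K_p0 (a, b, c, d, e, f, g) = Kfun a b c d e f g"

fun K_p1 :: "cvec7 \<Rightarrow> complex" where
  "K_p1 (a, b, c, d, e, f, g) = Kfun b c d a e f g"

fun L_3 :: "cvec7 \<Rightarrow> complex" where
  "L_3 (a, b, c, d, e, f, g) =
     Lfun a (1 + a - e) (1 + a - f) (1 + a - g) (1 + a - b) (1 + a - c) (1 + a - d)"

fun K_p0_defined :: "cvec7 \<Rightarrow> bool" where
  "K_p0_defined (a, b, c, d, e, f, g) = Kfun_defined a b c d e f g"

fun K_p1_defined :: "cvec7 \<Rightarrow> bool" where
  "K_p1_defined (a, b, c, d, e, f, g) = Kfun_defined b c d a e f g"

fun L_3_defined :: "cvec7 \<Rightarrow> bool" where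
  "L_3_defined (a, b, c, d, e, f, g) =
     Lfun_defined a (1 + a - e) (1 + a - f) (1 + a - g) (1 + a - b) (1 + a - c) (1 + a - d)"

end

theory Submission
  imports Defs
begin

text \<open>
  Multiplying \<open>K(a; \<dots>)\<close>, \<open>K(b; \<dots>)\<close> and \<open>L\<close> by their sines clears all sine denominators, since
  \<open>sin \<pi>(1 + a - b) = sin \<pi>(b - a)\<close>. Only three series then remain: the original one, cancelling
  between the two \<open>K\<close> functions, and its two companions based at \<open>a\<close> and at \<open>b\<close>, which are also
  the two series in \<open>L\<close>. The relation is thus an identity between linear combinations
  of the three series and holds coefficientwise.
\<close>

lemma F43_rotate_upper: "F43 b c d a e f g = F43 a b c d e f g"
  unfolding F43_def by (simp add: mult_ac)

lemma F43_rotate_lower: "F43 a b c d f g e = F43 a b c d e f g"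
  unfolding F43_def by (simp add: mult_ac)

lemma sin_pi_one_minus: "sin (of_real pi * (1 - z)) = sin (of_real pi * z)" for z :: complex
  by (simp add: right_diff_distrib sin_diff flip: sin_of_real cos_of_real)

lemma Sfun_mult_Kfun:
  assumes "sin (of_real pi * a) \<noteq> 0"
  shows "Sfun [a] * Kfun a b c d e f g =
      F43 a b c d e f g
        * Afun a (1 + a - e) (1 + a - f) (1 + a - g) * (rGamma e * rGamma f * rGamma g)
    + F43 a (1 + a - e) (1 + a - f) (1 + a - g) (1 + a - b) (1 + a - c) (1 + a - d)
        * Afun a b c d * (rGamma (1 + a - b) * rGamma (1 + a - c) * rGamma (1 + a - d))"
  using assms by (simp add: Sfun_def Kfun_def Afun_def field_simps)

lemma Sfun_mult_Lfun:
  assumes "sin (of_real pi * e) \<noteq> 0"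
  shows "Sfun [e] * Lfun a b c d e f g =
      F43 a b c d e f g
        * Afun (1 + a - e) (1 + b - e) (1 + c - e) (1 + d - e) * (rGamma e * rGamma f * rGamma g)
    - F43 (1 + a - e) (1 + b - e) (1 + c - e) (1 + d - e) (2 - e) (1 + f - e) (1 + g - e)
        * Afun a b c d * (rGamma (2 - e) * rGamma (1 + f - e) * rGamma (1 + g - e))"
  using assms by (simp add: Sfun_def Lfun_def Afun_def field_simps)

theorem proposition6p1:
  fixes a b c d e f g :: complex and x :: cvec7
  assumes x: "x = (a, b, c, d, e, f, g)"
    and "x \<in> Vset"
    and "K_p0_defined x" and "K_p1_defined x" and "L_3_defined x"
  shows "Sfun [a] * Afun b (1 + b - e) (1 + b - f) (1 + b - g) * K_p0 x
       - Sfun [b] * Afun a (1 + a - e) (1 + a - f) (1 + a - g) * K_p1 x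
       - Sfun [b - a] * Afun a b c d * L_3 x = 0"
proof -
  have sines: "sin (of_real pi * a) \<noteq> 0" "sin (of_real pi * b) \<noteq> 0"
      "sin (of_real pi * (1 + a - b)) \<noteq> 0"
    using assms by (simp_all add: Kfun_defined_def Lfun_defined_def)
  \<comment> \<open>Each series absorbs the \<open>rGamma\<close> factors of its lower parameters,
    so the coefficients left are the \<open>Afun\<close> products of the claim.\<close>
  define F where "F = F43 a b c d e f g * (rGamma e * rGamma f * rGamma g)"
  define Fa where
    "Fa = F43 a (1 + a - e) (1 + a - f) (1 + a - g) (1 + a - b) (1 + a - c) (1 + a - d)
       * (rGamma (1 + a - b) * rGamma (1 + a - c) * rGamma (1 + a - d))"
  define Fb where
    "Fb = F43 b (1 + b - e) (1 + b - f) (1 + b - g) (1 + b - a) (1 + b - c) (1 + b - d)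
       * (rGamma (1 + b - a) * rGamma (1 + b - c) * rGamma (1 + b - d))"
  define A where "A = Afun a b c d"
  define Aa where "Aa = Afun a (1 + a - e) (1 + a - f) (1 + a - g)"
  define Ab where "Ab = Afun b (1 + b - e) (1 + b - f) (1 + b - g)"
  note defs = F_def Fa_def Fb_def A_def Aa_def Ab_def
  have K0: "Sfun [a] * K_p0 x = Aa * F + A * Fa"
    using sines by (simp add: x Sfun_mult_Kfun defs mult_ac)
  have "Afun b c d a = A"
    by (simp add: Afun_def A_def mult_ac)
  \<comment> \<open>The fixed instances rotate the cyclically shifted parameters of
    \<open>K_p1\<close> into the order used in \<open>F\<close> and \<open>Fb\<close>.\<close>
  then have K1: "Sfun [b] * K_p1 x = Ab * F + A * Fb"
    using sines by (simp add: x Sfun_mult_Kfun F43_rotate_upper [of b c d a]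
        F43_rotate_lower [of _ _ _ _ "1 + b - c" "1 + b - d" "1 + b - a"] F_def Fb_def Ab_def mult_ac)
  have S: "Sfun [b - a] = Sfun [1 + a - b]"
    using sin_pi_one_minus [of "b - a"] by (simp add: Sfun_def algebra_simps)
  \<comment> \<open>Shifting by the distinguished lower parameter \<open>1 + a - b\<close> of
    \<open>L_3\<close> moves the base from \<open>a\<close> to \<open>b\<close>; \<open>y\<close> is
    \<open>e\<close>, \<open>f\<close>, \<open>g\<close> in upper and \<open>c\<close>,
    \<open>d\<close> in lower parameters.\<close>
  have shift: "1 + a - (1 + a - b) = b" "2 - (1 + a - b) = 1 + b - a"
      "1 + (1 + a - y) - (1 + a - b) = 1 + b - y" for y
    by simp_all
  have L: "Sfun [b - a] * L_3 x = Ab * Fa - Aa * Fb"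
    unfolding S x L_3.simps Sfun_mult_Lfun [OF sines(3)] shift defs by (simp only: mult_ac)
  have "Sfun [a] * Ab * K_p0 x - Sfun [b] * Aa * K_p1 x - Sfun [b - a] * A * L_3 x
      = Ab * (Sfun [a] * K_p0 x) - Aa * (Sfun [b] * K_p1 x) - A * (Sfun [b - a] * L_3 x)"
    by (simp add: mult_ac)
  \<comment> \<open>\<open>F\<close> cancels between the first two products, \<open>Fa\<close> and
    \<open>Fb\<close> against the third.\<close>
  also have "\<dots> = 0"
    unfolding K0 K1 L by (simp add: algebra_simps)
  finally show ?thesis
    by (simp add: defs)
qed

end
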